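(* Let $R$ be a commutative ring with identity, let $M$ be a faithful finitely generated coreduced comultiplication $R$-module, and let $N$ be a $dqz^\circ$-submodule of $M$. Then every submodule $S$ that is maximal under inclusion among the second submodules of $M$ contained in $N$ is a $dqz^\circ$-submodule of $M$.
   Context: For a submodule $K$ of $M$, an ideal $I$ of $R$ and $r\in R$: $(K:_Mr)=\{m\in M: rm\in K\}$, $(0:_MI)=\{m\in M: Im=0\}$, $(0:_Mr)=\{m\in M: rm=0\}$. $M$ is a comultiplication module if every submodule $N$ of $M$ has the form $N=(0:_MI)$ for some ideal $I$ of $R$. A proper submodule $L$ of $M$ is completely irreducible if $L=\bigcap_{i\in I}N_i$ for a family of submodules $N_i$ of $M$ implies $L=N_i$ for some $i$. $M$ is coreduced if for every $r\in R$ and every completely irreducible submodule $L$ of $M$, $(L:_Mr)=M$ implies $L+(0:_Mr)=M$. A non-zero submodule $S$ of $M$ is second if for each $a\in R$ multiplication by $a$ on $S$ is either surjective or zero. A maximal second submodule of $M$ is a second submodule of $M$ that is maximal under inclusion among the second submodules of $M$. For a submodule $K$ of $M$, $\mathfrak{S}_K$ is the sum of all maximal second submodules of $M$ contained in $K$ (and $0$ if there are none). A non-zero submodule $N$ of $M$ is a $dqz^\circ$-submodule of $M$ if $N\subseteq\mathfrak{S}_{(0:_Ma)}$ for all $a\in Ann_R(N)$. *)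

theory Defs
  imports "HOL-Algebra.Module" "HOL-Algebra.Ideal"
begin

definition residual_submodule ::
    "('a, 'b, 'm) module_scheme \<Rightarrow> 'b set \<Rightarrow> 'a \<Rightarrow> 'b set" where
  "residual_submodule M K r = {m \<in> carrier M. r \<odot>\<^bsub>M\<^esub> m \<in> K}"

abbreviation ann_in_module_elem :: "('a, 'b, 'm) module_scheme \<Rightarrow> 'a \<Rightarrow> 'b set" where
  "ann_in_module_elem M r \<equiv> residual_submodule M {\<zero>\<^bsub>M\<^esub>} r"

definition ann_in_module :: "('a, 'b, 'm) module_scheme \<Rightarrow> 'a set \<Rightarrow> 'b set" where
  "ann_in_module M I = {m \<in> carrier M. \<forall>r\<in>I. r \<odot>\<^bsub>M\<^esub> m = \<zero>\<^bsub>M\<^esub>}"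

definition ann_in_ring ::
    "('a, 'r) ring_scheme \<Rightarrow> ('a, 'b, 'm) module_scheme \<Rightarrow> 'b set \<Rightarrow> 'a set" where
  "ann_in_ring R M N = {r \<in> carrier R. \<forall>n\<in>N. r \<odot>\<^bsub>M\<^esub> n = \<zero>\<^bsub>M\<^esub>}"

definition faithful_module ::
    "('a, 'r) ring_scheme \<Rightarrow> ('a, 'b, 'm) module_scheme \<Rightarrow> bool" where
  "faithful_module R M \<longleftrightarrow> ann_in_ring R M (carrier M) = {\<zero>\<^bsub>R\<^esub>}"

definition fg_module ::
    "('a, 'r) ring_scheme \<Rightarrow> ('a, 'b, 'm) module_scheme \<Rightarrow> bool" where
  "fg_module R M \<longleftrightarrow> (\<exists>X. finite X \<and> X \<subseteq> carrier M \<and>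
     (\<forall>m\<in>carrier M. \<exists>c\<in>X \<rightarrow> carrier R. m = (\<Oplus>\<^bsub>M\<^esub>x\<in>X. c x \<odot>\<^bsub>M\<^esub> x)))"

definition comultiplication_module ::
    "('a, 'r) ring_scheme \<Rightarrow> ('a, 'b, 'm) module_scheme \<Rightarrow> bool" where
  "comultiplication_module R M \<longleftrightarrow>
     (\<forall>N. submodule N R M \<longrightarrow> (\<exists>I. ideal I R \<and> N = ann_in_module M I))"

text \<open>A family of submodules enters only through its set of members. The intersection is taken
  inside \<^term>\<open>carrier M\<close>, so that the empty family has intersection \<^term>\<open>carrier M\<close>; it imposes no
  condition because \<^term>\<open>L\<close> is proper.\<close>

definition completely_irreducible ::
    "('a, 'r) ring_scheme \<Rightarrow> ('a, 'b, 'm) module_scheme \<Rightarrow> 'b set \<Rightarrow> bool" where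
  "completely_irreducible R M L \<longleftrightarrow> submodule L R M \<and> L \<noteq> carrier M \<and>
     (\<forall>\<N>. (\<forall>N\<in>\<N>. submodule N R M) \<longrightarrow> L = carrier M \<inter> \<Inter>\<N> \<longrightarrow> L \<in> \<N>)"

definition coreduced_module ::
    "('a, 'r) ring_scheme \<Rightarrow> ('a, 'b, 'm) module_scheme \<Rightarrow> bool" where
  "coreduced_module R M \<longleftrightarrow>
     (\<forall>r\<in>carrier R. \<forall>L. completely_irreducible R M L \<longrightarrow>
        residual_submodule M L r = carrier M \<longrightarrow>
        L <+>\<^bsub>M\<^esub> ann_in_module_elem M r = carrier M)"

definition second_submodule ::
    "('a, 'r) ring_scheme \<Rightarrow> ('a, 'b, 'm) module_scheme \<Rightarrow> 'b set \<Rightarrow> bool" where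
  "second_submodule R M S \<longleftrightarrow> submodule S R M \<and> S \<noteq> {\<zero>\<^bsub>M\<^esub>} \<and>
     (\<forall>a\<in>carrier R. (\<lambda>x. a \<odot>\<^bsub>M\<^esub> x) ` S = S \<or> (\<forall>x\<in>S. a \<odot>\<^bsub>M\<^esub> x = \<zero>\<^bsub>M\<^esub>))"

definition maximal_second_submodule ::
    "('a, 'r) ring_scheme \<Rightarrow> ('a, 'b, 'm) module_scheme \<Rightarrow> 'b set \<Rightarrow> bool" where
  "maximal_second_submodule R M S \<longleftrightarrow> second_submodule R M S \<and>
     (\<forall>T. second_submodule R M T \<longrightarrow> S \<subseteq> T \<longrightarrow> T = S)"

text \<open>The sum of a possibly infinite family: all finite sums of elements taken from its members.
  It is \<open>{\<zero>\<^bsub>M\<^esub>}\<close> for the empty family.\<close>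

definition sum_of_submodules ::
    "('a, 'b, 'm) module_scheme \<Rightarrow> 'b set set \<Rightarrow> 'b set" where
  "sum_of_submodules M \<N> =
     {m. \<exists>\<F> x. finite \<F> \<and> \<F> \<subseteq> \<N> \<and> (\<forall>N\<in>\<F>. x N \<in> N) \<and> m = (\<Oplus>\<^bsub>M\<^esub>N\<in>\<F>. x N)}"

text \<open>The submodule $\mathfrak{S}_K$.\<close>

definition max_second_sum ::
    "('a, 'r) ring_scheme \<Rightarrow> ('a, 'b, 'm) module_scheme \<Rightarrow> 'b set \<Rightarrow> 'b set" where
  "max_second_sum R M K = sum_of_submodules M {S. maximal_second_submodule R M S \<and> S \<subseteq> K}"

text \<open>The $dqz^\circ$-submodules.\<close>

definition dqz_submodule ::
    "('a, 'r) ring_scheme \<Rightarrow> ('a, 'b, 'm) module_scheme \<Rightarrow> 'b set \<Rightarrow> bool" where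
  "dqz_submodule R M N \<longleftrightarrow> submodule N R M \<and> N \<noteq> {\<zero>\<^bsub>M\<^esub>} \<and>
     (\<forall>a\<in>ann_in_ring R M N. N \<subseteq> max_second_sum R M (ann_in_module_elem M a))"

end

theory Submission
  imports Defs
begin

text \<open>Maximal submodules are completely irreducible, so over a finitely generated module
  coreducedness forces \<open>M = aM + (0 :\<^sub>M a)\<close>, hence \<open>aM = a\<^sup>2M\<close>, for every \<open>a\<close>. Nakayama's argument
  then gives \<open>c\<close> such that \<open>b = 1 - ac\<close> annihilates \<open>aM\<close>. If \<open>a\<close> annihilates \<open>S\<close>, then \<open>b\<close> is the
  identity on \<open>S\<close>, while \<open>b\<close> kills every second submodule on which \<open>a\<close> is surjective. Multiplying by
  \<open>b\<close> an expression of an element of \<open>S \<subseteq> \<SS>\<^sub>M\<close> as a sum of elements of maximal second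
  submodules therefore leaves only summands from submodules of \<open>(0 :\<^sub>M a)\<close>.\<close>

section \<open>Linear spans\<close>

text \<open>One coefficient function on the whole of \<open>X\<close> suffices when \<open>X\<close>
  is finite, the case of interest; over an infinite \<open>X\<close> the sum defaults to
  zero.\<close>

definition lin_span :: "('a, 'r) ring_scheme \<Rightarrow> ('a, 'b, 'm) module_scheme \<Rightarrow> 'b set \<Rightarrow> 'b set" where
  "lin_span R M X = {\<Oplus>\<^bsub>M\<^esub>x\<in>X. c x \<odot>\<^bsub>M\<^esub> x | c. c \<in> X \<rightarrow> carrier R}"

lemma fg_module_iff_lin_span:
  "fg_module R M \<longleftrightarrow> (\<exists>X. finite X \<and> X \<subseteq> carrier M \<and> carrier M \<subseteq> lin_span R M X)"
  unfolding fg_module_def lin_span_def subset_eq mem_Collect_eq by meson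

context module
begin

lemma lin_span_closed:
  assumes "X \<subseteq> carrier M" shows "lin_span R M X \<subseteq> carrier M"
  using assms unfolding lin_span_def by (auto intro!: M.finsum_closed)

lemma lin_span_add:
  assumes X: "X \<subseteq> carrier M" and "u \<in> lin_span R M X" "v \<in> lin_span R M X"
  shows "u \<oplus>\<^bsub>M\<^esub> v \<in> lin_span R M X"
proof -
  from assms obtain c d where c: "c \<in> X \<rightarrow> carrier R" "u = (\<Oplus>\<^bsub>M\<^esub>x\<in>X. c x \<odot>\<^bsub>M\<^esub> x)"
    and d: "d \<in> X \<rightarrow> carrier R" "v = (\<Oplus>\<^bsub>M\<^esub>x\<in>X. d x \<odot>\<^bsub>M\<^esub> x)"
    unfolding lin_span_def by auto
  have cM: "(\<lambda>x. c x \<odot>\<^bsub>M\<^esub> x) \<in> X \<rightarrow> carrier M" and dM: "(\<lambda>x. d x \<odot>\<^bsub>M\<^esub> x) \<in> X \<rightarrow> carrier M"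
    using c d X by auto
  have "u \<oplus>\<^bsub>M\<^esub> v = (\<Oplus>\<^bsub>M\<^esub>x\<in>X. c x \<odot>\<^bsub>M\<^esub> x \<oplus>\<^bsub>M\<^esub> d x \<odot>\<^bsub>M\<^esub> x)"
    using M.finsum_addf[OF cM dM] c d by simp
  also have "\<dots> = (\<Oplus>\<^bsub>M\<^esub>x\<in>X. (c x \<oplus> d x) \<odot>\<^bsub>M\<^esub> x)"
    using X c d by (intro M.finsum_cong') (auto simp: Pi_iff subset_iff smult_l_distr)
  finally show ?thesis
    unfolding lin_span_def using c d by (auto intro!: exI[of _ "\<lambda>x. c x \<oplus> d x"])
qed

lemma lin_span_smult:
  assumes "finite X" and X: "X \<subseteq> carrier M" and r: "r \<in> carrier R" and "u \<in> lin_span R M X"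
  shows "r \<odot>\<^bsub>M\<^esub> u \<in> lin_span R M X"
proof -
  from assms obtain c where c: "c \<in> X \<rightarrow> carrier R" "u = (\<Oplus>\<^bsub>M\<^esub>x\<in>X. c x \<odot>\<^bsub>M\<^esub> x)"
    unfolding lin_span_def by auto
  have "r \<odot>\<^bsub>M\<^esub> u = (\<Oplus>\<^bsub>M\<^esub>x\<in>X. r \<odot>\<^bsub>M\<^esub> (c x \<odot>\<^bsub>M\<^esub> x))"
    unfolding c using c X assms(1) r by (intro finsum_smult_ldistr) auto
  also have "\<dots> = (\<Oplus>\<^bsub>M\<^esub>x\<in>X. (r \<otimes> c x) \<odot>\<^bsub>M\<^esub> x)"
    using X c r by (intro M.finsum_cong') (auto simp: Pi_iff subset_iff smult_assoc1)
  finally show ?thesis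
    unfolding lin_span_def using c r by (auto intro!: exI[of _ "\<lambda>x. r \<otimes> c x"])
qed

lemma lin_span_insertE:
  assumes "finite X" "x \<notin> X" "insert x X \<subseteq> carrier M" "u \<in> lin_span R M (insert x X)"
  obtains r v where "r \<in> carrier R" "v \<in> lin_span R M X" "u = r \<odot>\<^bsub>M\<^esub> x \<oplus>\<^bsub>M\<^esub> v"
proof -
  from assms obtain c where c: "c \<in> insert x X \<rightarrow> carrier R"
      "u = (\<Oplus>\<^bsub>M\<^esub>y\<in>insert x X. c y \<odot>\<^bsub>M\<^esub> y)"
    unfolding lin_span_def by auto
  have "u = c x \<odot>\<^bsub>M\<^esub> x \<oplus>\<^bsub>M\<^esub> (\<Oplus>\<^bsub>M\<^esub>y\<in>X. c y \<odot>\<^bsub>M\<^esub> y)"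
    unfolding c using assms c by (subst M.finsum_insert) auto
  then show thesis
    using c by (intro that[of "c x" "\<Oplus>\<^bsub>M\<^esub>y\<in>X. c y \<odot>\<^bsub>M\<^esub> y"]) (auto simp: lin_span_def)
qed

section \<open>Constructions of submodules\<close>

lemma submodule_finsum_closed:
  assumes H: "submodule H R M" and "f \<in> A \<rightarrow> H"
  shows "(\<Oplus>\<^bsub>M\<^esub>x\<in>A. f x) \<in> H"
proof -
  have zero: "\<zero>\<^bsub>M\<^esub> \<in> H"
    using subgroup.one_closed[OF submodule.axioms(1)[OF H]] by simp
  show ?thesis
  proof (cases "finite A")
    case True
    then show ?thesis using assms(2)
    proof (induction A rule: finite_induct)
      case empty
      then show ?case using zero by simp
    next
      case (insert x A)
      then show ?case
        using submoduleE(1)[OF H] submoduleE(5)[OF H] by (subst M.finsum_insert) auto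
    qed
  next
    \<comment> \<open>A sum over an infinite index set is zero by convention, and zero lies in
      \<open>H\<close>.\<close>
    case False
    then show ?thesis using zero by (simp add: M.finsum_infinite)
  qed
qed

lemma lin_span_subset_submodule:
  assumes "submodule H R M" "X \<subseteq> H"
  shows "lin_span R M X \<subseteq> H"
  using assms submoduleE(4)[OF assms(1)] unfolding lin_span_def
  by (auto intro!: submodule_finsum_closed)

lemma submodule_smult_image:
  assumes a: "a \<in> carrier R"
  shows "submodule ((\<lambda>m. a \<odot>\<^bsub>M\<^esub> m) ` carrier M) R M"
proof (rule submoduleI)
  show "\<zero>\<^bsub>M\<^esub> \<in> (\<lambda>m. a \<odot>\<^bsub>M\<^esub> m) ` carrier M"
    using a by (intro image_eqI[of _ _ "\<zero>\<^bsub>M\<^esub>"]) auto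
  show "\<ominus>\<^bsub>M\<^esub> u \<in> (\<lambda>m. a \<odot>\<^bsub>M\<^esub> m) ` carrier M"
    if "u \<in> (\<lambda>m. a \<odot>\<^bsub>M\<^esub> m) ` carrier M" for u
    using that a by (auto simp: smult_r_minus[symmetric])
  show "u \<oplus>\<^bsub>M\<^esub> v \<in> (\<lambda>m. a \<odot>\<^bsub>M\<^esub> m) ` carrier M"
    if "u \<in> (\<lambda>m. a \<odot>\<^bsub>M\<^esub> m) ` carrier M" "v \<in> (\<lambda>m. a \<odot>\<^bsub>M\<^esub> m) ` carrier M" for u v
    using that a by (auto simp: smult_r_distr[symmetric])
  \<comment> \<open>Commutativity of R turns r(am) into a(rm), which is again a multiple of
    a.\<close>
  show "r \<odot>\<^bsub>M\<^esub> u \<in> (\<lambda>m. a \<odot>\<^bsub>M\<^esub> m) ` carrier M"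
    if "r \<in> carrier R" "u \<in> (\<lambda>m. a \<odot>\<^bsub>M\<^esub> m) ` carrier M" for r u
    using that a by (auto simp: smult_assoc1[symmetric] R.m_comm[of r a])
      (auto simp: smult_assoc1)
qed (use a in auto)

lemma submodule_ann_in_module_elem:
  assumes "a \<in> carrier R"
  shows "submodule (ann_in_module_elem M a) R M"
proof (rule submoduleI)
  show "r \<odot>\<^bsub>M\<^esub> u \<in> ann_in_module_elem M a"
    if "r \<in> carrier R" "u \<in> ann_in_module_elem M a" for r u
    using that assms smult_assoc1[of a r u] smult_assoc1[of r a u]
    by (auto simp: residual_submodule_def R.m_comm)
qed (use assms in \<open>auto simp: residual_submodule_def smult_r_distr smult_r_minus\<close>)

lemma submodule_set_add:
  assumes H: "submodule H R M" and K: "submodule K R M"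
  shows "submodule (H <+>\<^bsub>M\<^esub> K) R M"
proof -
  note HC = subsetD[OF submoduleE(1)[OF H]] and KC = subsetD[OF submoduleE(1)[OF K]]
  have zero: "\<zero>\<^bsub>M\<^esub> \<in> H" "\<zero>\<^bsub>M\<^esub> \<in> K"
    using subgroup.one_closed[OF submodule.axioms(1)[OF H]]
      subgroup.one_closed[OF submodule.axioms(1)[OF K]] by simp_all
  show ?thesis
  proof (rule submoduleI)
    show "\<zero>\<^bsub>M\<^esub> \<in> H <+>\<^bsub>M\<^esub> K"
      using zero unfolding set_add_def' by force
    show "\<ominus>\<^bsub>M\<^esub> u \<in> H <+>\<^bsub>M\<^esub> K" if "u \<in> H <+>\<^bsub>M\<^esub> K" for u
    proof -
      from that obtain h k where hk: "h \<in> H" "k \<in> K" "u = h \<oplus>\<^bsub>M\<^esub> k"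
        unfolding set_add_def' by auto
      then have "\<ominus>\<^bsub>M\<^esub> u = \<ominus>\<^bsub>M\<^esub> h \<oplus>\<^bsub>M\<^esub> \<ominus>\<^bsub>M\<^esub> k"
        using HC KC by (simp add: M.minus_add)
      then show ?thesis
        unfolding set_add_def' using submoduleE(3)[OF H hk(1)] submoduleE(3)[OF K hk(2)] by auto
    qed
    show "u \<oplus>\<^bsub>M\<^esub> v \<in> H <+>\<^bsub>M\<^esub> K" if uv: "u \<in> H <+>\<^bsub>M\<^esub> K" "v \<in> H <+>\<^bsub>M\<^esub> K" for u v
    proof -
      from uv obtain h k h' k' where hk: "h \<in> H" "k \<in> K" "u = h \<oplus>\<^bsub>M\<^esub> k"
        "h' \<in> H" "k' \<in> K" "v = h' \<oplus>\<^bsub>M\<^esub> k'"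
        unfolding set_add_def' by auto
      then have "u \<oplus>\<^bsub>M\<^esub> v = (h \<oplus>\<^bsub>M\<^esub> h') \<oplus>\<^bsub>M\<^esub> (k \<oplus>\<^bsub>M\<^esub> k')"
        using HC KC by (simp add: M.a_ac)
      then show ?thesis
        unfolding set_add_def' using submoduleE(5)[OF H hk(1,4)] submoduleE(5)[OF K hk(2,5)]
        by auto
    qed
    show "r \<odot>\<^bsub>M\<^esub> u \<in> H <+>\<^bsub>M\<^esub> K" if r: "r \<in> carrier R" and u: "u \<in> H <+>\<^bsub>M\<^esub> K" for r u
    proof -
      from u obtain h k where hk: "h \<in> H" "k \<in> K" "u = h \<oplus>\<^bsub>M\<^esub> k"
        unfolding set_add_def' by auto
      then have "r \<odot>\<^bsub>M\<^esub> u = r \<odot>\<^bsub>M\<^esub> h \<oplus>\<^bsub>M\<^esub> r \<odot>\<^bsub>M\<^esub> k"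
        using r HC KC by (simp add: smult_r_distr)
      then show ?thesis
        unfolding set_add_def' using submoduleE(4)[OF H r hk(1)] submoduleE(4)[OF K r hk(2)]
        by auto
    qed
  qed (auto simp: set_add_def' HC KC)
qed

lemma submodule_Union_chain:
  assumes "\<C> \<noteq> {}" and sub: "\<And>H. H \<in> \<C> \<Longrightarrow> submodule H R M"
    and chain: "\<And>H K. H \<in> \<C> \<Longrightarrow> K \<in> \<C> \<Longrightarrow> H \<subseteq> K \<or> K \<subseteq> H"
  shows "submodule (\<Union>\<C>) R M"
proof (rule submoduleI)
  show "\<Union>\<C> \<subseteq> carrier M" using submoduleE(1)[OF sub] by blast
  show "\<zero>\<^bsub>M\<^esub> \<in> \<Union>\<C>"
    using assms(1) subgroup.one_closed[OF submodule.axioms(1)[OF sub]] by auto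
  show "\<ominus>\<^bsub>M\<^esub> u \<in> \<Union>\<C>" if "u \<in> \<Union>\<C>" for u
    using that submoduleE(3)[OF sub] by blast
  show "u \<oplus>\<^bsub>M\<^esub> v \<in> \<Union>\<C>" if uv: "u \<in> \<Union>\<C>" "v \<in> \<Union>\<C>" for u v
  proof -
    from uv obtain H where "H \<in> \<C>" "u \<in> H" "v \<in> H" using chain by blast
    then show ?thesis using submoduleE(5)[OF sub] by blast
  qed
  show "r \<odot>\<^bsub>M\<^esub> u \<in> \<Union>\<C>" if "r \<in> carrier R" "u \<in> \<Union>\<C>" for r u
    using that submoduleE(4)[OF sub] by blast
qed

section \<open>Maximal submodules and the decomposition M = aM + (0 : a)\<close>

text \<open>Zorn's lemma applies because finite generation makes properness pass to unions of
  chains.\<close>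

lemma fg_module_maximal_submodule:
  assumes "fg_module R M" and K: "submodule K R M" "K \<noteq> carrier M"
  obtains L where "submodule L R M" "K \<subseteq> L" "L \<noteq> carrier M"
    "\<And>H. submodule H R M \<Longrightarrow> L \<subseteq> H \<Longrightarrow> H = L \<or> H = carrier M"
proof -
  obtain X where X: "finite X" "X \<subseteq> carrier M" "carrier M \<subseteq> lin_span R M X"
    using assms(1) unfolding fg_module_iff_lin_span by auto
  \<comment> \<open>Properness becomes the failure to contain one fixed finite set of
    generators.\<close>
  have proper: "H \<noteq> carrier M \<longleftrightarrow> \<not> X \<subseteq> H" if "submodule H R M" for H
    using lin_span_subset_submodule[OF that, of X] X submoduleE(1)[OF that] by blast
  let ?A = "{H. submodule H R M \<and> K \<subseteq> H \<and> H \<noteq> carrier M}"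
  have "\<exists>L\<in>?A. \<forall>H\<in>?A. L \<subseteq> H \<longrightarrow> H = L"
  proof (rule subset_Zorn_nonempty)
    show "?A \<noteq> {}" using K by blast
    fix \<C> assume ne: "\<C> \<noteq> {}" and ch: "subset.chain ?A \<C>"
    then have mem: "submodule H R M" "K \<subseteq> H" "H \<noteq> carrier M" if "H \<in> \<C>" for H
      using that by (auto simp: subset_chain_def)
    have sub: "submodule (\<Union>\<C>) R M"
      using ne mem(1) ch by (intro submodule_Union_chain) (auto simp: subset_chain_def)
    have "\<not> X \<subseteq> \<Union>\<C>"
    proof
      \<comment> \<open>A finite set covered by a nonempty chain already lies in a single member,
        which would then be all of M.\<close>
      assume "X \<subseteq> \<Union>\<C>"
      then obtain H where "H \<in> \<C>" "X \<subseteq> H"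
        using finite_subset_Union_chain[OF X(1) _ ne ch] by blast
      then show False using mem proper by blast
    qed
    then show "\<Union>\<C> \<in> ?A" using sub proper[OF sub] ne mem(2) by blast
  qed
  then obtain L where "L \<in> ?A" and max: "\<forall>H\<in>?A. L \<subseteq> H \<longrightarrow> H = L"
    by (rule bexE)
  then have L: "submodule L R M" "K \<subseteq> L" "L \<noteq> carrier M" by simp_all
  have "H = L \<or> H = carrier M" if "submodule H R M" "L \<subseteq> H" for H
    using bspec[OF max, of H] that L(2) by auto
  then show thesis by (rule that[OF L])
qed

lemma maximal_submodule_completely_irreducible:
  assumes L: "submodule L R M" "L \<noteq> carrier M"
    and max: "\<And>H. submodule H R M \<Longrightarrow> L \<subseteq> H \<Longrightarrow> H = L \<or> H = carrier M"
  shows "completely_irreducible R M L"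
  unfolding completely_irreducible_def
proof (intro conjI allI impI L)
  fix \<N> assume sub: "\<forall>H\<in>\<N>. submodule H R M" and eq: "L = carrier M \<inter> \<Inter>\<N>"
  \<comment> \<open>Since \<open>L\<close> is proper, some member \<open>H\<close> of the family is
    not all of M; it contains \<open>L\<close>, so maximality forces it to be
    \<open>L\<close>.\<close>
  then obtain H where "H \<in> \<N>" "\<not> carrier M \<subseteq> H" using L by blast
  then show "L \<in> \<N>" using max[of H] sub eq by auto
qed

text \<open>Otherwise a maximal submodule \<open>L\<close> contains both aM and (0 : a). The first
  inclusion makes coreducedness applicable and yields L + (0 : a) = M, while the second says that
  this sum is only \<open>L\<close>.\<close>

lemma coreduced_fg_decomposition:
  assumes fg: "fg_module R M" and cored: "coreduced_module R M" and a: "a \<in> carrier R"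
  shows "(\<lambda>m. a \<odot>\<^bsub>M\<^esub> m) ` carrier M <+>\<^bsub>M\<^esub> ann_in_module_elem M a = carrier M"
    (is "?I <+>\<^bsub>M\<^esub> ?K = _")
proof (rule ccontr)
  assume neq: "?I <+>\<^bsub>M\<^esub> ?K \<noteq> carrier M"
  note I = submodule_smult_image[OF a] and K = submodule_ann_in_module_elem[OF a]
  obtain L where L: "submodule L R M" "?I <+>\<^bsub>M\<^esub> ?K \<subseteq> L" "L \<noteq> carrier M"
    "\<And>H. submodule H R M \<Longrightarrow> L \<subseteq> H \<Longrightarrow> H = L \<or> H = carrier M"
    by (rule fg_module_maximal_submodule[OF fg submodule_set_add[OF I K] neq]) iprover
  have "\<zero>\<^bsub>M\<^esub> \<in> ?I" "\<zero>\<^bsub>M\<^esub> \<in> ?K"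
    using subgroup.one_closed[OF submodule.axioms(1)[OF I]]
      subgroup.one_closed[OF submodule.axioms(1)[OF K]] by simp_all
  then have "?I \<subseteq> ?I <+>\<^bsub>M\<^esub> ?K" "?K \<subseteq> ?I <+>\<^bsub>M\<^esub> ?K"
    using submoduleE(1)[OF I] submoduleE(1)[OF K] unfolding set_add_def'
    by (force intro: M.r_zero[symmetric], force intro: M.l_zero[symmetric])
  then have IL: "?I \<subseteq> L" and KL: "?K \<subseteq> L" using L(2) by auto
  have "residual_submodule M L a = carrier M"
    using IL by (auto simp: residual_submodule_def)
  then have "L <+>\<^bsub>M\<^esub> ?K = carrier M"
    using cored a maximal_submodule_completely_irreducible[OF L(1,3,4)]
    unfolding coreduced_module_def by blast
  moreover have "L <+>\<^bsub>M\<^esub> ?K \<subseteq> L"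
    using KL submoduleE(5)[OF L(1)] by (auto simp: set_add_def')
  ultimately show False using L(1,3) submoduleE(1) by blast
qed

section \<open>Nakayama's argument for aM\<close>

text \<open>The assumption \<open>idem\<close> expresses aM = a^2 M. Generators are eliminated one
  at a time, each at the cost of a further factor congruent to 1 modulo a, until none is left. The
  resulting \<open>d\<close> is the negative of the element c in the opening outline.\<close>

lemma fg_idempotent_smult_annihilator:
  assumes fg: "fg_module R M" and a: "a \<in> carrier R"
    and idem: "\<And>m. m \<in> carrier M \<Longrightarrow> \<exists>t\<in>carrier M. a \<odot>\<^bsub>M\<^esub> m = a \<odot>\<^bsub>M\<^esub> (a \<odot>\<^bsub>M\<^esub> t)"
  obtains d where "d \<in> carrier R" "\<And>m. m \<in> carrier M \<Longrightarrow> (\<one> \<oplus> a \<otimes> d) \<odot>\<^bsub>M\<^esub> (a \<odot>\<^bsub>M\<^esub> m) = \<zero>\<^bsub>M\<^esub>"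
proof -
  \<comment> \<open>The invariant of the elimination: b is congruent to 1 modulo a, and b maps aM
    into a times the span of X.\<close>
  define good where "good X b \<longleftrightarrow> b \<in> carrier R \<and> (\<exists>d\<in>carrier R. b = \<one> \<oplus> a \<otimes> d) \<and>
    (\<forall>m\<in>carrier M. \<exists>u\<in>lin_span R M X. b \<odot>\<^bsub>M\<^esub> (a \<odot>\<^bsub>M\<^esub> m) = a \<odot>\<^bsub>M\<^esub> u)" for X b
  have step: "\<exists>b. good X b"
    if X: "finite X" "x \<notin> X" "insert x X \<subseteq> carrier M" and "good (insert x X) b" for X x b
  proof -
    from that(4) obtain d where b: "b \<in> carrier R" and d: "d \<in> carrier R" "b = \<one> \<oplus> a \<otimes> d"
      and red: "\<And>m. m \<in> carrier M \<Longrightarrow>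
        \<exists>u\<in>lin_span R M (insert x X). b \<odot>\<^bsub>M\<^esub> (a \<odot>\<^bsub>M\<^esub> m) = a \<odot>\<^bsub>M\<^esub> u"
      unfolding good_def by blast
    have x: "x \<in> carrier M" and XM: "X \<subseteq> carrier M" using X by auto
    note sC = subsetD[OF lin_span_closed[OF XM]]
    \<comment> \<open>Writing ax = a(at) gains a factor a: reducing b(at) to a(rx + v) and
      multiplying by a gives b(ax) = a(a(rx + v)), in which the x-part is ar times ax.\<close>
    obtain t where t: "t \<in> carrier M" "a \<odot>\<^bsub>M\<^esub> x = a \<odot>\<^bsub>M\<^esub> (a \<odot>\<^bsub>M\<^esub> t)" using idem[OF x] by blast
    obtain r v where r: "r \<in> carrier R" and v: "v \<in> lin_span R M X"
      and rv: "b \<odot>\<^bsub>M\<^esub> (a \<odot>\<^bsub>M\<^esub> t) = a \<odot>\<^bsub>M\<^esub> (r \<odot>\<^bsub>M\<^esub> x \<oplus>\<^bsub>M\<^esub> v)"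
    proof -
      from red[OF t(1)] obtain u where "u \<in> lin_span R M (insert x X)"
        "b \<odot>\<^bsub>M\<^esub> (a \<odot>\<^bsub>M\<^esub> t) = a \<odot>\<^bsub>M\<^esub> u" by blast
      then show thesis using lin_span_insertE[OF X] that by metis
    qed
    note vC = sC[OF v]
    \<comment> \<open>Subtracting ar cancels the x-part of b(ax), leaving a(av), and keeps the
      multiplier congruent to 1 modulo a.\<close>
    define b' where "b' = b \<ominus> a \<otimes> r"
    have b': "b' \<in> carrier R" using b a r by (simp add: b'_def)
    have bx: "b \<odot>\<^bsub>M\<^esub> (a \<odot>\<^bsub>M\<^esub> x) = (a \<otimes> r) \<odot>\<^bsub>M\<^esub> (a \<odot>\<^bsub>M\<^esub> x) \<oplus>\<^bsub>M\<^esub> a \<odot>\<^bsub>M\<^esub> (a \<odot>\<^bsub>M\<^esub> v)"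
    proof -
      have "b \<odot>\<^bsub>M\<^esub> (a \<odot>\<^bsub>M\<^esub> x) = a \<odot>\<^bsub>M\<^esub> (b \<odot>\<^bsub>M\<^esub> (a \<odot>\<^bsub>M\<^esub> t))"
        unfolding t(2) using a b t(1) by (simp add: smult_assoc1[symmetric] R.m_ac)
      also have "\<dots> = a \<odot>\<^bsub>M\<^esub> (a \<odot>\<^bsub>M\<^esub> (r \<odot>\<^bsub>M\<^esub> x)) \<oplus>\<^bsub>M\<^esub> a \<odot>\<^bsub>M\<^esub> (a \<odot>\<^bsub>M\<^esub> v)"
        unfolding rv using a r x vC by (simp add: smult_r_distr)
      also have "a \<odot>\<^bsub>M\<^esub> (a \<odot>\<^bsub>M\<^esub> (r \<odot>\<^bsub>M\<^esub> x)) = (a \<otimes> r) \<odot>\<^bsub>M\<^esub> (a \<odot>\<^bsub>M\<^esub> x)"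
        using a r x by (simp add: smult_assoc1[symmetric] R.m_ac)
      finally show ?thesis .
    qed
    have b'x: "b' \<odot>\<^bsub>M\<^esub> (a \<odot>\<^bsub>M\<^esub> x) = a \<odot>\<^bsub>M\<^esub> (a \<odot>\<^bsub>M\<^esub> v)"
    proof -
      have "b' \<odot>\<^bsub>M\<^esub> (a \<odot>\<^bsub>M\<^esub> x) =
          b \<odot>\<^bsub>M\<^esub> (a \<odot>\<^bsub>M\<^esub> x) \<oplus>\<^bsub>M\<^esub> \<ominus>\<^bsub>M\<^esub> ((a \<otimes> r) \<odot>\<^bsub>M\<^esub> (a \<odot>\<^bsub>M\<^esub> x))"
        unfolding b'_def R.minus_eq using a b r x by (simp add: smult_l_distr smult_l_minus)
      then show ?thesis unfolding bx using a r x vC by (simp add: M.a_ac M.r_neg)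
    qed
    \<comment> \<open>First \<open>b\<close> brings am to the form a(sx + w); then \<open>b'\<close>
      moves the remaining x-part into a times the span of X.\<close>
    have "good X (b' \<otimes> b)"
      unfolding good_def
    proof (intro conjI ballI)
      show "b' \<otimes> b \<in> carrier R" using b b' by simp
      have dr: "d \<ominus> r \<in> carrier R" using d(1) r by simp
      have "b' = \<one> \<oplus> a \<otimes> (d \<ominus> r)"
        unfolding b'_def d(2) R.minus_eq using a r d(1)
        by (simp add: R.r_distr R.r_minus R.a_assoc)
      \<comment> \<open>Since b' = 1 + a(d - r), the product is b + a(d - r)b; inserting b = 1 + ad
        gives the witness d + (d - r)b.\<close>
      then have "b' \<otimes> b = b \<oplus> a \<otimes> ((d \<ominus> r) \<otimes> b)"
        using a dr b by (simp add: R.l_distr R.m_assoc)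
      also have "\<dots> = \<one> \<oplus> a \<otimes> (d \<oplus> (d \<ominus> r) \<otimes> b)"
        using a dr b d by (simp add: R.r_distr R.a_assoc)
      finally show "\<exists>d\<in>carrier R. b' \<otimes> b = \<one> \<oplus> a \<otimes> d"
        using dr b d(1) by (intro bexI[of _ "d \<oplus> (d \<ominus> r) \<otimes> b"]) simp_all
      fix m assume m: "m \<in> carrier M"
      obtain s w where s: "s \<in> carrier R" and w: "w \<in> lin_span R M X"
        and sw: "b \<odot>\<^bsub>M\<^esub> (a \<odot>\<^bsub>M\<^esub> m) = a \<odot>\<^bsub>M\<^esub> (s \<odot>\<^bsub>M\<^esub> x \<oplus>\<^bsub>M\<^esub> w)"
      proof -
        from red[OF m] obtain u where "u \<in> lin_span R M (insert x X)"
          "b \<odot>\<^bsub>M\<^esub> (a \<odot>\<^bsub>M\<^esub> m) = a \<odot>\<^bsub>M\<^esub> u" by blast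
        then show thesis using lin_span_insertE[OF X] that by metis
      qed
      note wC = sC[OF w]
      have "(b' \<otimes> b) \<odot>\<^bsub>M\<^esub> (a \<odot>\<^bsub>M\<^esub> m) = b' \<odot>\<^bsub>M\<^esub> (a \<odot>\<^bsub>M\<^esub> (s \<odot>\<^bsub>M\<^esub> x \<oplus>\<^bsub>M\<^esub> w))"
        using b b' a m by (simp add: smult_assoc1 sw)
      also have "\<dots> = b' \<odot>\<^bsub>M\<^esub> (a \<odot>\<^bsub>M\<^esub> (s \<odot>\<^bsub>M\<^esub> x)) \<oplus>\<^bsub>M\<^esub> b' \<odot>\<^bsub>M\<^esub> (a \<odot>\<^bsub>M\<^esub> w)"
        using b' a s x wC by (simp add: smult_r_distr)
      also have "b' \<odot>\<^bsub>M\<^esub> (a \<odot>\<^bsub>M\<^esub> (s \<odot>\<^bsub>M\<^esub> x)) = s \<odot>\<^bsub>M\<^esub> (b' \<odot>\<^bsub>M\<^esub> (a \<odot>\<^bsub>M\<^esub> x))"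
        using b' a s x by (simp add: smult_assoc1[symmetric] R.m_ac)
      \<comment> \<open>By \<open>b'x\<close> the x-part becomes s(a(av)) = a((sa)v), so the witness
        in the span of X will be (sa)v + b'w.\<close>
      also have "\<dots> = a \<odot>\<^bsub>M\<^esub> ((s \<otimes> a) \<odot>\<^bsub>M\<^esub> v)"
        unfolding b'x using a s vC by (simp add: smult_assoc1[symmetric] R.m_ac)
      also have "b' \<odot>\<^bsub>M\<^esub> (a \<odot>\<^bsub>M\<^esub> w) = a \<odot>\<^bsub>M\<^esub> (b' \<odot>\<^bsub>M\<^esub> w)"
        using a b' wC by (simp add: smult_assoc1[symmetric] R.m_ac)
      also have "a \<odot>\<^bsub>M\<^esub> ((s \<otimes> a) \<odot>\<^bsub>M\<^esub> v) \<oplus>\<^bsub>M\<^esub> a \<odot>\<^bsub>M\<^esub> (b' \<odot>\<^bsub>M\<^esub> w) =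
          a \<odot>\<^bsub>M\<^esub> ((s \<otimes> a) \<odot>\<^bsub>M\<^esub> v \<oplus>\<^bsub>M\<^esub> b' \<odot>\<^bsub>M\<^esub> w)"
        using a s b' vC wC by (simp add: smult_r_distr)
      finally show "\<exists>u\<in>lin_span R M X. (b' \<otimes> b) \<odot>\<^bsub>M\<^esub> (a \<odot>\<^bsub>M\<^esub> m) = a \<odot>\<^bsub>M\<^esub> u"
        by (rule bexI) (intro lin_span_add lin_span_smult X(1) XM v w b' R.m_closed s a)
    qed
    then show ?thesis ..
  qed
  have reduce: "(\<exists>b. good X b) \<longrightarrow> (\<exists>b. good {} b)" if "finite X" "X \<subseteq> carrier M" for X
    using that
  proof (induction X rule: finite_induct)
    case (insert x X)
    then show ?case using step[of X x] by blast
  qed simp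
  obtain X where X: "finite X" "X \<subseteq> carrier M" "carrier M \<subseteq> lin_span R M X"
    using fg unfolding fg_module_iff_lin_span by auto
  \<comment> \<open>The elimination starts from a full generating set, with 1 = 1 + a0.\<close>
  have "good X \<one>"
    unfolding good_def using X(3) a by (auto intro!: bexI[of _ \<zero>])
  then obtain b where "good {} b" using reduce X by blast
  \<comment> \<open>The span of the empty set is zero, so the invariant now says that b annihilates
    aM.\<close>
  then obtain d where "d \<in> carrier R"
    "\<And>m. m \<in> carrier M \<Longrightarrow> (\<one> \<oplus> a \<otimes> d) \<odot>\<^bsub>M\<^esub> (a \<odot>\<^bsub>M\<^esub> m) = \<zero>\<^bsub>M\<^esub>"
    using a unfolding good_def lin_span_def by auto
  then show thesis by (rule that)
qed

text \<open>If m = at + k with ak = 0, then am = a(at), which is what Nakayama's argument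
  requires.\<close>

lemma coreduced_fg_annihilator:
  assumes fg: "fg_module R M" and cored: "coreduced_module R M" and a: "a \<in> carrier R"
  obtains d where "d \<in> carrier R" "\<And>m. m \<in> carrier M \<Longrightarrow> (\<one> \<oplus> a \<otimes> d) \<odot>\<^bsub>M\<^esub> (a \<odot>\<^bsub>M\<^esub> m) = \<zero>\<^bsub>M\<^esub>"
proof (rule fg_idempotent_smult_annihilator[OF fg a])
  fix m assume "m \<in> carrier M"
  then have "m \<in> (\<lambda>m. a \<odot>\<^bsub>M\<^esub> m) ` carrier M <+>\<^bsub>M\<^esub> ann_in_module_elem M a"
    using coreduced_fg_decomposition[OF fg cored a] by simp
  then obtain t k where "t \<in> carrier M" "k \<in> carrier M" "a \<odot>\<^bsub>M\<^esub> k = \<zero>\<^bsub>M\<^esub>" "m = a \<odot>\<^bsub>M\<^esub> t \<oplus>\<^bsub>M\<^esub> k"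
    unfolding set_add_def' residual_submodule_def by auto
  then show "\<exists>t\<in>carrier M. a \<odot>\<^bsub>M\<^esub> m = a \<odot>\<^bsub>M\<^esub> (a \<odot>\<^bsub>M\<^esub> t)"
    using a by (auto simp: smult_r_distr)
next
  fix d assume "d \<in> carrier R"
    "\<And>m. m \<in> carrier M \<Longrightarrow> (\<one> \<oplus> a \<otimes> d) \<odot>\<^bsub>M\<^esub> (a \<odot>\<^bsub>M\<^esub> m) = \<zero>\<^bsub>M\<^esub>"
  then show thesis by (rule that)
qed

section \<open>Discarding summands not annihilated by a\<close>

text \<open>Stated for a single element, so that it can be used with \<open>K\<close> equal to (0 :
  0) = M. All that is taken from \<open>K\<close> is one finite expression of \<open>x\<close> by
  maximal second submodules, which multiplication by 1 + ad then filters.\<close>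

lemma max_second_sum_ann_in_module_elem:
  assumes fg: "fg_module R M" and cored: "coreduced_module R M"
    and a: "a \<in> carrier R" and x: "x \<in> max_second_sum R M K" "a \<odot>\<^bsub>M\<^esub> x = \<zero>\<^bsub>M\<^esub>"
  shows "x \<in> max_second_sum R M (ann_in_module_elem M a)"
proof -
  obtain d where d: "d \<in> carrier R"
    and kill: "\<And>m. m \<in> carrier M \<Longrightarrow> (\<one> \<oplus> a \<otimes> d) \<odot>\<^bsub>M\<^esub> (a \<odot>\<^bsub>M\<^esub> m) = \<zero>\<^bsub>M\<^esub>"
    using coreduced_fg_annihilator[OF fg cored a] by blast
  define b where "b = \<one> \<oplus> a \<otimes> d"
  have b: "b \<in> carrier R" using a d by (simp add: b_def)
  from x(1) obtain \<F> f where F: "finite \<F>"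
    and sub_F: "\<F> \<subseteq> {S. maximal_second_submodule R M S \<and> S \<subseteq> K}"
    and mem_f: "\<forall>T\<in>\<F>. f T \<in> T" and xf: "x = (\<Oplus>\<^bsub>M\<^esub>T\<in>\<F>. f T)"
    unfolding max_second_sum_def sum_of_submodules_def mem_Collect_eq by iprover
  note f = bspec[OF mem_f]
  have maxsec: "maximal_second_submodule R M T" if "T \<in> \<F>" for T
    using sub_F that by auto
  have sec: "second_submodule R M T" if "T \<in> \<F>" for T
    using maxsec[OF that] by (simp add: maximal_second_submodule_def)
  have sub: "submodule T R M" if "T \<in> \<F>" for T
    using sec[OF that] by (simp add: second_submodule_def)
  have fM: "f T \<in> carrier M" if "T \<in> \<F>" for T
    using f[OF that] submoduleE(1)[OF sub[OF that]] by blast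
  have xM: "x \<in> carrier M" unfolding xf using fM by (intro M.finsum_closed) auto
  \<comment> \<open>These are the summands on which a acts as zero; by secondness a is surjective on
    every other one.\<close>
  let ?G = "{T \<in> \<F>. T \<subseteq> ann_in_module_elem M a}"
  have vanish: "b \<odot>\<^bsub>M\<^esub> f T = \<zero>\<^bsub>M\<^esub>" if T: "T \<in> \<F> - ?G" for T
  proof -
    have "T \<subseteq> carrier M" using T submoduleE(1)[OF sub] by blast
    then have "(\<lambda>x. a \<odot>\<^bsub>M\<^esub> x) ` T = T"
      using T sec[of T] a unfolding second_submodule_def residual_submodule_def by blast
    \<comment> \<open>Surjectivity puts the summand into aM, which \<open>b\<close>
      annihilates.\<close>
    then obtain t where "t \<in> T" "f T = a \<odot>\<^bsub>M\<^esub> t" using f[of T] T by blast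
    then show ?thesis using kill \<open>T \<subseteq> carrier M\<close> by (auto simp: b_def)
  qed
  have "x = b \<odot>\<^bsub>M\<^esub> x"
  proof -
    \<comment> \<open>Commuting the factors of ad exposes ax = 0, so \<open>b\<close> fixes
      \<open>x\<close>.\<close>
    have "b \<odot>\<^bsub>M\<^esub> x = x \<oplus>\<^bsub>M\<^esub> d \<odot>\<^bsub>M\<^esub> (a \<odot>\<^bsub>M\<^esub> x)"
      unfolding b_def using a d xM by (simp add: smult_l_distr smult_assoc1[symmetric] R.m_comm)
    then show ?thesis using x(2) d xM by simp
  qed
  also have "\<dots> = (\<Oplus>\<^bsub>M\<^esub>T\<in>\<F>. b \<odot>\<^bsub>M\<^esub> f T)"
    unfolding xf using F b fM by (intro finsum_smult_ldistr) auto
  also have "\<dots> = (\<Oplus>\<^bsub>M\<^esub>T\<in>?G. b \<odot>\<^bsub>M\<^esub> f T)"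
    using F b fM vanish by (intro M.add.finprod_mono_neutral_cong_right) auto
  finally have "x = (\<Oplus>\<^bsub>M\<^esub>T\<in>?G. b \<odot>\<^bsub>M\<^esub> f T)" .
  \<comment> \<open>Multiplication by \<open>b\<close> keeps each summand in its own submodule, so
    the filtered sum is again an admissible expression.\<close>
  moreover have "\<forall>T\<in>?G. b \<odot>\<^bsub>M\<^esub> f T \<in> T" using submoduleE(4)[OF sub b] f by auto
  moreover have "?G \<subseteq> {S. maximal_second_submodule R M S \<and> S \<subseteq> ann_in_module_elem M a}"
    using maxsec by auto
  moreover have "finite ?G" using F by simp
  ultimately show ?thesis
    unfolding max_second_sum_def sum_of_submodules_def mem_Collect_eq by iprover
qed

end

theorem theorem4p15:
  fixes R :: "('a, 'r) ring_scheme" and M :: "('a, 'b, 'm) module_scheme"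
    and N S :: "'b set"
  assumes "module R M"
    and "faithful_module R M"
    and "fg_module R M"
    and "coreduced_module R M"
    and "comultiplication_module R M"
    and "dqz_submodule R M N"
    and "second_submodule R M S" and "S \<subseteq> N"
    and "\<And>T. second_submodule R M T \<Longrightarrow> T \<subseteq> N \<Longrightarrow> S \<subseteq> T \<Longrightarrow> T = S"
  shows "dqz_submodule R M S"
proof -
  interpret module R M by fact
  have "N \<subseteq> carrier M" using assms(6) submoduleE(1) by (simp add: dqz_submodule_def)
  \<comment> \<open>The assumption on \<open>N\<close> is used at the annihilator 0: since (0 : 0) =
    M, it places \<open>N\<close> inside the sum of all maximal second submodules of M.\<close>
  then have "\<zero>\<^bsub>R\<^esub> \<in> ann_in_ring R M N" by (auto simp: ann_in_ring_def)
  then have NS: "N \<subseteq> max_second_sum R M (ann_in_module_elem M \<zero>\<^bsub>R\<^esub>)"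
    using assms(6) by (simp add: dqz_submodule_def)
  show ?thesis
    unfolding dqz_submodule_def
  proof (intro conjI ballI subsetI)
    show "submodule S R M" "S \<noteq> {\<zero>\<^bsub>M\<^esub>}" using assms(7) by (auto simp: second_submodule_def)
    fix a x assume "a \<in> ann_in_ring R M S" "x \<in> S"
    then show "x \<in> max_second_sum R M (ann_in_module_elem M a)"
      \<comment> \<open>The inclusion of \<open>S\<close> in \<open>N\<close> supplies an expression
        of x by maximal second submodules, and ax = 0 because a annihilates
        \<open>S\<close>.\<close>
      using NS assms(8)
      by (intro max_second_sum_ann_in_module_elem[OF assms(3,4)]) (auto simp: ann_in_ring_def)
  qed
qed

end
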